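(* For every sequence $\{x_k\}_{k\ge1}$ generated by the Aggregating Newton Method (defined in the context), for all $k\ge1$, $$Q_k^*:=\min_x Q_k(x)\;\ge\;A_kF(x_k)-\frac{C_k}{2}.$$ Consequently, for the choice $A_k:=k^3$, there is an absolute constant $C>0$ such that for all $k\ge1$ $$F(x_k)-F^*\;\le\;F(x_k)-\frac{Q_k^*}{A_k}+\frac{C_k}{2A_k}\;\le\;\frac{C_k}{A_k}\;\le\;C\,\frac{H_\nu D^{2+\nu}}{k^{1+\nu}}.$$
   Context: Problem: minimize $F(x)=f(x)+\psi(x)$ over $x\in\mathbb{R}^n$, with optimal value $F^*$, where $\psi:\mathbb{R}^n\to\mathbb{R}\cup\{+\infty\}$ is a proper closed convex function and $f$ is convex and twice continuously differentiable at every point of $\operatorname{dom}\psi=\{x:\psi(x)<+\infty\}$. $\langle\cdot,\cdot\rangle$ is the standard scalar product on $\mathbb{R}^n$ and $\|\cdot\|$ is an arbitrary fixed (possibly non-Euclidean) norm on $\mathbb{R}^n$, with dual norm $\|s\|_*=\sup_{\|h\|\le 1}\langle s,h\rangle$ and induced matrix norm $\|A\|=\sup_{\|h\|\le1}\|Ah\|_*$. The domain is bounded: $D:=\sup_{x,y\in\operatorname{dom}\psi}\|x-y\|<+\infty$. The Hessian of $f$ is Hölder continuous of degree $\nu\in[0,1]$ on $\operatorname{dom}\psi$ with constant $0\le H_\nu<+\infty$: $\|\nabla^2 f(x)-\nabla^2 f(y)\|\le H_\nu\|x-y\|^\nu$ for all $x,y\in\operatorname{dom}\psi$. Aggregating Newton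 Method: choose $x_0\in\operatorname{dom}\psi$, set $A_0:=0$ and $Q_0(x)\equiv0$. For $k\ge0$: pick $a_{k+1}>0$, set $A_{k+1}:=A_k+a_{k+1}$ and $\gamma_k:=a_{k+1}/A_{k+1}$; set $$Q_{k+1}(x):=Q_k(x)+a_{k+1}\Bigl[f(x_k)+\langle\nabla f(x_k),x-x_k\rangle+\frac{\gamma_k}{2}\langle\nabla^2 f(x_k)(x-x_k),x-x_k\rangle+\psi(x)\Bigr];$$ take any $v_{k+1}\in\operatorname{Argmin}_xQ_{k+1}(x)$ and set $x_{k+1}:=x_k+\gamma_k(v_{k+1}-x_k)$. Moreover $C_k:=\frac{2H_\nu D^{2+\nu}}{(1+\nu)(2+\nu)}\sum_{i=0}^{k-1}a_{i+1}\gamma_i^{1+\nu}$. The choice $A_k:=k^3$ means $a_{k+1}=(k+1)^3-k^3$. An absolute constant is one independent of $k$, $n$, $\nu$, $H_\nu$, $D$, $f$, $\psi$, the norm and $x_0$. *)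

theory Defs
  imports "HOL-Analysis.Analysis"
begin

definition is_norm :: "('a::real_vector \<Rightarrow> real) \<Rightarrow> bool" where
  "is_norm N \<longleftrightarrow>
     (\<forall>x. 0 \<le> N x) \<and> (\<forall>x. N x = 0 \<longleftrightarrow> x = 0) \<and>
     (\<forall>c x. N (c *\<^sub>R x) = \<bar>c\<bar> * N x) \<and> (\<forall>x y. N (x + y) \<le> N x + N y)"

definition dual_norm :: "('a::real_inner \<Rightarrow> real) \<Rightarrow> 'a \<Rightarrow> real" where
  "dual_norm N s = (SUP h\<in>{h. N h \<le> 1}. s \<bullet> h)"

definition mat_norm :: "(real ^ 'n \<Rightarrow> real) \<Rightarrow> real ^ 'n ^ 'n \<Rightarrow> real" where
  "mat_norm N M = (SUP h\<in>{h. N h \<le> 1}. dual_norm N (M *v h))"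

definition edom :: "('a \<Rightarrow> ereal) \<Rightarrow> 'a set" where
  "edom \<psi> = {x. \<psi> x < \<infinity>}"

definition epi :: "('a \<Rightarrow> ereal) \<Rightarrow> ('a \<times> real) set" where
  "epi \<psi> = {(x, t). \<psi> x \<le> ereal t}"

definition proper_closed_convex :: "('a::real_normed_vector \<Rightarrow> ereal) \<Rightarrow> bool" where
  "proper_closed_convex \<psi> \<longleftrightarrow>
     (\<forall>x. \<psi> x \<noteq> -\<infinity>) \<and> edom \<psi> \<noteq> {} \<and> convex (epi \<psi>) \<and> closed (epi \<psi>)"

text \<open>A real supremum, hence meaningful only together with the boundedness condition
  in \<open>composite_problem\<close> below.\<close>

definition dom_diam :: "('a::real_vector \<Rightarrow> real) \<Rightarrow> ('a \<Rightarrow> ereal) \<Rightarrow> real" where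
  "dom_diam N \<psi> = (SUP (x, y)\<in>edom \<psi> \<times> edom \<psi>. N (x - y))"

definition gradient :: "('a::real_inner \<Rightarrow> real) \<Rightarrow> 'a \<Rightarrow> 'a" where
  "gradient f x = (THE g. GDERIV f x :> g)"

definition hessian :: "(real ^ 'n \<Rightarrow> real) \<Rightarrow> real ^ 'n \<Rightarrow> real ^ 'n ^ 'n" where
  "hessian f x = jacobian (gradient f) (at x)"

definition twice_cont_diff_at :: "(real ^ 'n \<Rightarrow> real) \<Rightarrow> real ^ 'n \<Rightarrow> bool" where
  "twice_cont_diff_at f x \<longleftrightarrow>
     (\<forall>\<^sub>F y in nhds x. f differentiable (at y) \<and> gradient f differentiable (at y)) \<and>
     isCont (hessian f) x"

definition objective :: "('a \<Rightarrow> real) \<Rightarrow> ('a \<Rightarrow> ereal) \<Rightarrow> 'a \<Rightarrow> ereal" where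
  "objective f \<psi> x = ereal (f x) + \<psi> x"

definition opt_value :: "('a \<Rightarrow> real) \<Rightarrow> ('a \<Rightarrow> ereal) \<Rightarrow> ereal" where
  "opt_value f \<psi> = (INF x. objective f \<psi> x)"

text \<open>The smooth part \<open>f\<close> is represented by a total real function, of which only the
  convexity on \<open>edom \<psi>\<close> and the behaviour near the points of \<open>edom \<psi>\<close> are constrained;
  so \<open>f\<close> may also stand for an extended-valued convex function that is finite near
  \<open>edom \<psi>\<close>.  For \<open>\<nu> = 0\<close> and \<open>x = y\<close> the library convention \<open>0 powr 0 = 0\<close> is harmless,
  since the left-hand side of the Hoelder condition vanishes.\<close>

definition composite_problem ::
  "(real ^ 'n \<Rightarrow> real) \<Rightarrow> (real ^ 'n \<Rightarrow> real) \<Rightarrow> (real ^ 'n \<Rightarrow> ereal) \<Rightarrow> real \<Rightarrow> real \<Rightarrow> bool" where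
  "composite_problem N f \<psi> \<nu> H \<longleftrightarrow>
     is_norm N \<and> proper_closed_convex \<psi> \<and>
     convex_on (edom \<psi>) f \<and> (\<forall>x\<in>edom \<psi>. twice_cont_diff_at f x) \<and>
     bdd_above ((\<lambda>(x, y). N (x - y)) ` (edom \<psi> \<times> edom \<psi>)) \<and>
     0 \<le> \<nu> \<and> \<nu> \<le> 1 \<and> 0 \<le> H \<and>
     (\<forall>x\<in>edom \<psi>. \<forall>y\<in>edom \<psi>.
        mat_norm N (hessian f x - hessian f y) \<le> H * N (x - y) powr \<nu>)"

text \<open>The step parameters are \<open>a 1, a 2, \<dots>\<close>; the value \<open>a 0\<close> is never used.\<close>

primrec agg_A :: "(nat \<Rightarrow> real) \<Rightarrow> nat \<Rightarrow> real" where
  "agg_A a 0 = 0"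
| "agg_A a (Suc k) = agg_A a k + a (Suc k)"

definition agg_gamma :: "(nat \<Rightarrow> real) \<Rightarrow> nat \<Rightarrow> real" where
  "agg_gamma a k = a (Suc k) / agg_A a (Suc k)"

primrec agg_Q ::
  "(real ^ 'n \<Rightarrow> real) \<Rightarrow> (real ^ 'n \<Rightarrow> ereal) \<Rightarrow> (nat \<Rightarrow> real) \<Rightarrow> (nat \<Rightarrow> real ^ 'n) \<Rightarrow>
     nat \<Rightarrow> real ^ 'n \<Rightarrow> ereal" where
  "agg_Q f \<psi> a x 0 = (\<lambda>y. 0)"
| "agg_Q f \<psi> a x (Suc k) = (\<lambda>y. agg_Q f \<psi> a x k y +
     ereal (a (Suc k)) *
       (ereal (f (x k) + gradient f (x k) \<bullet> (y - x k) +
               agg_gamma a k / 2 * ((hessian f (x k) *v (y - x k)) \<bullet> (y - x k))) + \<psi> y))"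

definition agg_Qmin ::
  "(real ^ 'n \<Rightarrow> real) \<Rightarrow> (real ^ 'n \<Rightarrow> ereal) \<Rightarrow> (nat \<Rightarrow> real) \<Rightarrow> (nat \<Rightarrow> real ^ 'n) \<Rightarrow>
     nat \<Rightarrow> ereal" where
  "agg_Qmin f \<psi> a x k = (INF y. agg_Q f \<psi> a x k y)"

definition aggregating_newton ::
  "(real ^ 'n \<Rightarrow> real) \<Rightarrow> (real ^ 'n \<Rightarrow> ereal) \<Rightarrow> (nat \<Rightarrow> real) \<Rightarrow> (nat \<Rightarrow> real ^ 'n) \<Rightarrow>
     (nat \<Rightarrow> real ^ 'n) \<Rightarrow> bool" where
  "aggregating_newton f \<psi> a x v \<longleftrightarrow>
     x 0 \<in> edom \<psi> \<and>
     (\<forall>k. a (Suc k) > 0 \<and>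
          is_arg_min (agg_Q f \<psi> a x (Suc k)) (\<lambda>_. True) (v (Suc k)) \<and>
          x (Suc k) = x k + agg_gamma a k *\<^sub>R (v (Suc k) - x k))"

text \<open>The error term \<open>agg_C\<close> depends on numbers only: no type variable for the dimension
  occurs in it.  A constant \<open>C\<close> bounding \<open>agg_C\<close> uniformly in its arguments can therefore
  be chosen once for all dimensions, which a quantifier over problems on the type
  \<open>real ^ 'n\<close>, placed under the existential quantifier for \<open>C\<close>, could not express alone.\<close>

definition agg_C :: "real \<Rightarrow> real \<Rightarrow> real \<Rightarrow> (nat \<Rightarrow> real) \<Rightarrow> nat \<Rightarrow> real" where
  "agg_C \<nu> H D a k = 2 * H * D powr (2 + \<nu>) / ((1 + \<nu>) * (2 + \<nu>)) *
     (\<Sum>i<k. a (Suc i) * agg_gamma a i powr (1 + \<nu>))"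

definition cubic_steps :: "(nat \<Rightarrow> real) \<Rightarrow> bool" where
  "cubic_steps a \<longleftrightarrow> (\<forall>k. a (Suc k) = real (Suc k) ^ 3 - real k ^ 3)"

end

theory Submission
  imports Defs
begin

text \<open>
  Everything rests on one Taylor estimate.  For \<open>x, y\<close> in the domain of \<open>\<psi>\<close> and
  \<open>z = x + \<gamma> (y - x)\<close>, the Hoelder condition says that \<open>f z\<close> differs from its second-order
  Taylor polynomial at \<open>x\<close> by at most \<open>\<gamma>\<^sup>2\<^sup>+\<^sup>\<nu> E\<close>, where
  \<open>E = H D\<^sup>2\<^sup>+\<^sup>\<nu> / ((1 + \<nu>) (2 + \<nu>))\<close>.  That polynomial is the convex combination
  \<open>(1 - \<gamma>) f x + \<gamma> m y\<close>, with \<open>m\<close> the model of \<open>f\<close> at \<open>x\<close> in which the quadratic term is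
  damped by \<open>\<gamma>\<close>; this is exactly the model which the method adds to \<open>Q\<close>.  With
  \<open>\<gamma> = \<gamma>\<^sub>k\<close> the error, weighted by \<open>A\<^sub>k\<^sub>+\<^sub>1\<close>, is
  \<open>\<delta>\<^sub>k = a\<^sub>k\<^sub>+\<^sub>1 \<gamma>\<^sub>k\<^sup>1\<^sup>+\<^sup>\<nu> E\<close>, and \<open>C\<^sub>k / 2\<close> is the sum of \<open>\<delta>\<^sub>i\<close> over \<open>i < k\<close>.

  The estimate is used in both directions (\<open>taylor_step\<close>).  Taken at \<open>y = v\<^sub>k\<^sub>+\<^sub>1\<close>,
  where \<open>z = x\<^sub>k\<^sub>+\<^sub>1\<close>, and combined with the convexity of \<open>\<psi>\<close>, its upper half shows by
  induction that \<open>Q\<^sub>k\<close> stays above \<open>A\<^sub>k F (x\<^sub>k) - C\<^sub>k / 2\<close> (\<open>estimate_lower\<close>).  For arbitrary \<open>y\<close>, the lower half and the convexity of \<open>f\<close> along the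
  segment show that the damped model overestimates \<open>f y\<close> by at most \<open>\<delta>\<^sub>k / a\<^sub>k\<^sub>+\<^sub>1\<close>, so that
  \<open>Q\<^sub>k \<le> A\<^sub>k F + C\<^sub>k / 2\<close> (\<open>estimate_upper\<close>).  These two bounds enclose the optimal
  value and give the gap \<open>C\<^sub>k / A\<^sub>k\<close>.

  For \<open>A\<^sub>k = k\<^sup>3\<close> one has \<open>a\<^sub>m \<le> 3 m\<^sup>2\<close> and \<open>\<gamma>\<^sub>m\<^sub>-\<^sub>1 \<le> 3 / m\<close>, so every term of the sum
  in \<open>C\<^sub>k\<close> is at most \<open>27 k\<^sup>1\<^sup>-\<^sup>\<nu>\<close>; the constant 27 results.
\<close>

section \<open>Norms on a finite-dimensional space\<close>

text \<open>In finite dimension \<open>N\<close> is continuous, being convex, so that it has a positive minimum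
  on the Euclidean unit sphere.  The bound makes the suprema in the dual and the matrix norm
  suprema of bounded sets; a real supremum says nothing otherwise.\<close>

lemma norm_le_is_norm:
  fixes N :: "'a::euclidean_space \<Rightarrow> real"
  assumes "is_norm N"
  obtains c where "c > 0" "\<And>x. norm x \<le> c * N x"
proof -
  have sc: "N (r *\<^sub>R x) = \<bar>r\<bar> * N x" and tri: "N (x + y) \<le> N x + N y"
    and nn: "0 \<le> N x" and z: "N x = 0 \<longleftrightarrow> x = 0" for r x y
    using assms by (auto simp: is_norm_def)
  have "convex_on UNIV N"
  proof (rule convex_onI)
    fix t :: real and x y assume "0 < t" "t < 1"
    then show "N ((1 - t) *\<^sub>R x + t *\<^sub>R y) \<le> (1 - t) * N x + t * N y"
      using tri[of "(1 - t) *\<^sub>R x" "t *\<^sub>R y"] by (simp add: sc)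
  qed simp
  then have cont: "continuous_on UNIV N"
    by (intro convex_on_continuous) auto
  obtain b :: 'a where "norm b = 1"
    using vector_choose_size[of 1] by auto
  then have ne: "sphere (0::'a) 1 \<noteq> {}" by auto
  obtain u where u: "u \<in> sphere 0 1" "\<And>x. x \<in> sphere 0 1 \<Longrightarrow> N u \<le> N x"
    using continuous_attains_inf[OF compact_sphere ne continuous_on_subset[OF cont subset_UNIV]]
    by blast
  have pos: "N u > 0"
    using u(1) nn[of u] z[of u] by force
  have "norm x \<le> (1 / N u) * N x" for x
  proof (cases "x = 0")
    case False
    have "N u \<le> N ((1 / norm x) *\<^sub>R x)"
      using False by (intro u(2)) simp
    then show ?thesis
      using False pos by (simp add: sc field_simps)
  qed (use nn pos in simp)
  with pos show thesis
    by (intro that[of "1 / N u"]) auto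
qed

lemma dual_norm_ge:
  fixes N :: "'a::euclidean_space \<Rightarrow> real"
  assumes N: "is_norm N" and h: "N h \<le> 1"
  shows "s \<bullet> h \<le> dual_norm N s"
proof -
  obtain c where c: "c > 0" "\<And>x. norm x \<le> c * N x"
    using norm_le_is_norm[OF N] by blast
  have "s \<bullet> x \<le> norm s * c" if "N x \<le> 1" for x
  proof -
    have "s \<bullet> x \<le> norm s * norm x" by (rule norm_cauchy_schwarz)
    also have "norm x \<le> c"
      using c(2)[of x] mult_left_mono[OF that, of c] c(1) by linarith
    then have "norm s * norm x \<le> norm s * c"
      by (rule mult_left_mono) simp
    finally show ?thesis .
  qed
  then have "bdd_above ((\<bullet>) s ` {x. N x \<le> 1})"
    by (intro bdd_aboveI[of _ "norm s * c"]) auto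
  then show ?thesis
    unfolding dual_norm_def using h by (intro cSUP_upper) auto
qed

lemma inner_le_dual_norm:
  fixes N :: "'a::euclidean_space \<Rightarrow> real"
  assumes N: "is_norm N"
  shows "\<bar>s \<bullet> h\<bar> \<le> dual_norm N s * N h"
proof (cases "h = 0")
  case False
  have pos: "N h > 0"
    using N False unfolding is_norm_def by (metis less_eq_real_def)
  have "s \<bullet> ((r / N h) *\<^sub>R h) \<le> dual_norm N s" if "\<bar>r\<bar> = 1" for r
    using N pos that by (intro dual_norm_ge) (auto simp: is_norm_def)
  from this[of 1] this[of "-1"] show ?thesis
    using pos by (simp add: field_simps abs_le_iff)
next
  case True
  then have "N h = 0"
    using N by (simp add: is_norm_def)
  with True show ?thesis by simp
qed

text \<open>The duality inequality, applied to \<open>M *v e\<close> and \<open>e\<close> for the normalised vector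
  \<open>e = h / N h\<close>.  It is the only way in which the Hoelder condition on the Hessian is
  used.\<close>

lemma quadratic_form_le_mat_norm:
  fixes N :: "real ^ 'n \<Rightarrow> real"
  assumes N: "is_norm N"
  shows "\<bar>(M *v h) \<bullet> h\<bar> \<le> mat_norm N M * (N h)\<^sup>2"
proof (cases "h = 0")
  case False
  have sc: "N (r *\<^sub>R x) = \<bar>r\<bar> * N x" for r x
    using N by (auto simp: is_norm_def)
  have pos: "N h > 0"
    using N False unfolding is_norm_def by (metis less_eq_real_def)
  obtain c where c: "c > 0" "\<And>x. norm x \<le> c * N x"
    using norm_le_is_norm[OF N] by blast
  have small: "norm x \<le> c" if "N x \<le> 1" for x
    using c(2)[of x] mult_left_mono[OF that, of c] c(1) by linarith
  have "dual_norm N (M *v x) \<le> onorm ((*v) M) * c * c" if x: "N x \<le> 1" for x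
    unfolding dual_norm_def
  proof (rule cSUP_least)
    show "{h. N h \<le> 1} \<noteq> {}"
      using x by auto
    fix y assume "y \<in> {h. N h \<le> 1}"
    then have y: "norm y \<le> c" using small by auto
    have "norm (M *v x) \<le> onorm ((*v) M) * norm x"
      by (rule onorm[OF matrix_vector_mul_bounded_linear])
    also have "\<dots> \<le> onorm ((*v) M) * c"
      by (rule mult_left_mono[OF small[OF x] onorm_pos_le[OF matrix_vector_mul_bounded_linear]])
    finally have Mx: "norm (M *v x) \<le> onorm ((*v) M) * c" .
    have "norm (M *v x) * norm y \<le> onorm ((*v) M) * c * c"
      by (rule mult_mono[OF Mx y order_trans[OF norm_ge_zero Mx] norm_ge_zero])
    then show "(M *v x) \<bullet> y \<le> onorm ((*v) M) * c * c"
      using norm_cauchy_schwarz[of "M *v x" y] by linarith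
  qed
  then have bdd: "bdd_above ((\<lambda>h. dual_norm N (M *v h)) ` {h. N h \<le> 1})"
    by (intro bdd_aboveI[of _ "onorm ((*v) M) * c * c"]) auto
  define e where "e = (1 / N h) *\<^sub>R h"
  have e: "N e = 1" and h: "h = N h *\<^sub>R e"
    using pos by (auto simp: e_def sc)
  have "\<bar>(M *v e) \<bullet> e\<bar> \<le> dual_norm N (M *v e)"
    using inner_le_dual_norm[OF N, of "M *v e" e] e by simp
  also have "\<dots> \<le> mat_norm N M"
    unfolding mat_norm_def by (rule cSUP_upper[OF _ bdd]) (simp add: e)
  finally have "\<bar>(M *v e) \<bullet> e\<bar> * (N h)\<^sup>2 \<le> mat_norm N M * (N h)\<^sup>2"
    by (simp add: mult_right_mono)
  moreover have "(M *v h) \<bullet> h = ((M *v e) \<bullet> e) * (N h)\<^sup>2"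
    by (subst (1 2) h) (simp add: matrix_vector_mult_scaleR power2_eq_square mult_ac)
  ultimately show ?thesis
    by (simp add: abs_mult)
next
  case True
  then have "N h = 0"
    using N by (simp add: is_norm_def)
  with True show ?thesis by simp
qed

section \<open>Taylor expansion with Hoelder second derivative\<close>

text \<open>The Hoelder bound is integrated twice.  Subtracting from \<open>\<phi>'\<close> its first-order
  polynomial and the once integrated bound gives a function \<open>e\<close> with \<open>e 0 = 0\<close> and derivative
  at most \<open>0\<close>; doing the same one order higher with \<open>\<phi>\<close> gives \<open>E\<close> with derivative \<open>e \<le> 0\<close>,
  and \<open>E 1 \<le> E 0\<close> is the claim.  The powers of \<open>t\<close> are differentiated at \<open>t > 0\<close> only;
  at \<open>0\<close> continuity suffices, so the bound on \<open>\<phi>''\<close> need hold in the open interval only.\<close>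

lemma holder_taylor_upper:
  fixes \<phi> \<phi>' \<phi>'' :: "real \<Rightarrow> real"
  assumes \<nu>: "\<nu> \<ge> 0"
    and d1: "\<And>t. t \<in> {0..1} \<Longrightarrow> (\<phi> has_real_derivative \<phi>' t) (at t)"
    and d2: "\<And>t. t \<in> {0..1} \<Longrightarrow> (\<phi>' has_real_derivative \<phi>'' t) (at t)"
    and hold: "\<And>t. t \<in> {0<..<1} \<Longrightarrow> \<phi>'' t - \<phi>'' 0 \<le> K * t powr \<nu>"
  shows "\<phi> 1 - \<phi> 0 - \<phi>' 0 - \<phi>'' 0 / 2 \<le> K / ((1 + \<nu>) * (2 + \<nu>))"
proof -
  define e where "e t = \<phi>' t - \<phi>' 0 - t * \<phi>'' 0 - K * t powr (1 + \<nu>) / (1 + \<nu>)" for t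
  define E where "E t = \<phi> t - t * \<phi>' 0 - t\<^sup>2 * \<phi>'' 0 / 2
    - K * t powr (2 + \<nu>) / ((1 + \<nu>) * (2 + \<nu>))" for t
  have c: "continuous_on {0..1} \<phi>" "continuous_on {0..1} \<phi>'"
    by (intro continuous_at_imp_continuous_on ballI DERIV_isCont[OF d1] DERIV_isCont[OF d2]; simp)+
  have cp: "continuous_on {0..1::real} (\<lambda>t. t powr (1 + \<nu>))"
    "continuous_on {0..1::real} (\<lambda>t. t powr (2 + \<nu>))"
    using \<nu> by (intro continuous_on_powr' continuous_on_id continuous_on_const; simp)+
  have e: "e t \<le> 0" if t: "t \<in> {0..1}" for t
  proof -
    have "e t \<le> e 0"
    proof (rule DERIV_nonpos_imp_decreasing_open[of 0 t e])
      show "0 \<le> t" using t by simp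
      show "continuous_on {0..t} e"
        unfolding e_def using t \<nu>
        by (intro continuous_intros continuous_on_subset[OF c(2)] continuous_on_subset[OF cp(1)]) auto
      fix s assume s: "0 < s" "s < t"
      have "(\<phi>' has_real_derivative \<phi>'' s) (at s)"
        by (rule d2) (use s t in simp)
      then have "(e has_real_derivative \<phi>'' s - \<phi>'' 0 - K * s powr \<nu>) (at s)"
        unfolding e_def using s \<nu> by (auto intro!: derivative_eq_intros)
      moreover have "\<phi>'' s - \<phi>'' 0 - K * s powr \<nu> \<le> 0"
        using hold[of s] s t by simp
      ultimately show "\<exists>y. (e has_real_derivative y) (at s) \<and> y \<le> 0" by blast
    qed
    then show ?thesis by (simp add: e_def)
  qed
  have "E 1 \<le> E 0"
  proof (rule DERIV_nonpos_imp_decreasing_open[of 0 1 E])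
    show "continuous_on {0..1} E"
      unfolding E_def using \<nu>
      by (intro continuous_intros c cp) auto
    fix s :: real assume s: "0 < s" "s < 1"
    have "(\<phi> has_real_derivative \<phi>' s) (at s)"
      by (rule d1) (use s in simp)
    then have "(E has_real_derivative \<phi>' s - \<phi>' 0 - s * \<phi>'' 0
        - K * ((2 + \<nu>) * s powr (1 + \<nu>)) / ((1 + \<nu>) * (2 + \<nu>))) (at s)"
      unfolding E_def using s \<nu> by (auto intro!: derivative_eq_intros simp: add.commute)
    also have "\<phi>' s - \<phi>' 0 - s * \<phi>'' 0
        - K * ((2 + \<nu>) * s powr (1 + \<nu>)) / ((1 + \<nu>) * (2 + \<nu>)) = e s"
      unfolding e_def using \<nu> by simp
    finally have "(E has_real_derivative e s) (at s)" .
    then show "\<exists>y. (E has_real_derivative y) (at s) \<and> y \<le> 0"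
      using e[of s] s by auto
  qed simp
  then show ?thesis by (simp add: E_def)
qed

lemma holder_taylor:
  fixes \<phi> \<phi>' \<phi>'' :: "real \<Rightarrow> real"
  assumes \<nu>: "\<nu> \<ge> 0"
    and d1: "\<And>t. t \<in> {0..1} \<Longrightarrow> (\<phi> has_real_derivative \<phi>' t) (at t)"
    and d2: "\<And>t. t \<in> {0..1} \<Longrightarrow> (\<phi>' has_real_derivative \<phi>'' t) (at t)"
    and hold: "\<And>t. t \<in> {0<..<1} \<Longrightarrow> \<bar>\<phi>'' t - \<phi>'' 0\<bar> \<le> K * t powr \<nu>"
  shows "\<bar>\<phi> 1 - \<phi> 0 - \<phi>' 0 - \<phi>'' 0 / 2\<bar> \<le> K / ((1 + \<nu>) * (2 + \<nu>))"
proof -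
  have "\<phi> 1 - \<phi> 0 - \<phi>' 0 - \<phi>'' 0 / 2 \<le> K / ((1 + \<nu>) * (2 + \<nu>))"
    by (rule holder_taylor_upper[OF \<nu> d1 d2]) (use hold in \<open>force simp: abs_le_iff\<close>)+
  moreover have "- \<phi> 1 - - \<phi> 0 - - \<phi>' 0 - - \<phi>'' 0 / 2 \<le> K / ((1 + \<nu>) * (2 + \<nu>))"
    by (rule holder_taylor_upper[OF \<nu>, where \<phi> = "\<lambda>t. - \<phi> t" and \<phi>' = "\<lambda>t. - \<phi>' t"
          and \<phi>'' = "\<lambda>t. - \<phi>'' t"])
      (use d1 d2 hold in \<open>auto intro!: derivative_eq_intros simp: abs_le_iff\<close>)
  ultimately show ?thesis by (simp add: abs_le_iff)
qed

text \<open>The gradient is a definite description; existence is the Riesz representation of the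
  derivative, obtained from its adjoint at \<open>1\<close>.\<close>

lemma gderiv_gradient:
  fixes f :: "'a::euclidean_space \<Rightarrow> real"
  assumes "f differentiable (at x)"
  shows "GDERIV f x :> gradient f x"
proof -
  obtain f' where f': "(f has_derivative f') (at x)"
    using assms by (auto simp: differentiable_def)
  interpret bounded_linear f' using f' by (rule has_derivative_bounded_linear)
  have "f' = (\<lambda>h. h \<bullet> adjoint f' 1)"
    using adjoint_works[OF linear_axioms, of _ 1] by simp
  then have g: "GDERIV f x :> adjoint f' 1"
    using f' by (simp add: gderiv_def)
  have "D = adjoint f' 1" if "GDERIV f x :> D" for D
  proof -
    have "(\<lambda>h. h \<bullet> D) = (\<lambda>h. h \<bullet> adjoint f' 1)"
      using that g unfolding gderiv_def by (rule has_derivative_unique)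
    then have "h \<bullet> D = h \<bullet> adjoint f' 1" for h
      by (rule fun_cong)
    then show ?thesis
      using vector_eq_ldot[of D "adjoint f' 1"] by blast
  qed
  with g show ?thesis
    unfolding gradient_def by (rule theI)
qed

section \<open>The composite problem\<close>

lemma real_of_convex_function:
  assumes "proper_closed_convex \<psi>" and "x \<in> edom \<psi>"
  shows "\<psi> x = ereal (real_of_ereal (\<psi> x))"
  using assms by (cases "\<psi> x") (auto simp: proper_closed_convex_def edom_def)

text \<open>Jensen's inequality for an extended-valued function whose convexity is that of its
  epigraph.\<close>

lemma convex_function_segment:
  assumes \<psi>: "proper_closed_convex \<psi>" and x: "x \<in> edom \<psi>" and y: "y \<in> edom \<psi>"
    and t: "0 \<le> t" "t \<le> 1"
  shows "\<psi> (x + t *\<^sub>R (y - x)) \<le> ereal ((1 - t) * real_of_ereal (\<psi> x) + t * real_of_ereal (\<psi> y))"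
proof -
  have conv: "convex (epi \<psi>)"
    using \<psi> by (simp add: proper_closed_convex_def)
  have "(x, real_of_ereal (\<psi> x)) \<in> epi \<psi>" "(y, real_of_ereal (\<psi> y)) \<in> epi \<psi>"
    using real_of_convex_function[OF \<psi>] x y by (auto simp: epi_def)
  then have "(1 - t) *\<^sub>R (x, real_of_ereal (\<psi> x)) + t *\<^sub>R (y, real_of_ereal (\<psi> y)) \<in> epi \<psi>"
    using t by (intro convexD[OF conv]) auto
  then show ?thesis
    by (simp add: epi_def algebra_simps)
qed

lemma edom_segment:
  assumes "proper_closed_convex \<psi>" "x \<in> edom \<psi>" "y \<in> edom \<psi>" "0 \<le> t" "t \<le> 1"
  shows "x + t *\<^sub>R (y - x) \<in> edom \<psi>"
  using convex_function_segment[OF assms] by (auto simp: edom_def intro: le_less_trans)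

lemma dom_diam_upper:
  assumes P: "composite_problem N f \<psi> \<nu> H" and x: "x \<in> edom \<psi>" and y: "y \<in> edom \<psi>"
  shows "N (y - x) \<le> dom_diam N \<psi>"
proof -
  have bdd: "bdd_above ((\<lambda>(x, y). N (x - y)) ` (edom \<psi> \<times> edom \<psi>))"
    using P by (simp add: composite_problem_def)
  show ?thesis
    unfolding dom_diam_def using cSUP_upper[OF _ bdd, of "(y, x)"] x y by simp
qed

text \<open>Restricting \<open>f\<close> to the line through \<open>x\<close> in the direction \<open>w = \<gamma> (y - x)\<close> reduces the
  claim to the one-dimensional expansion.  The length of \<open>w\<close> is at most \<open>\<gamma> D\<close>: one factor
  \<open>(N w)\<^sup>\<nu>\<close> of the error comes from the Hoelder condition and \<open>(N w)\<^sup>2\<close> from the quadratic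
  form, whence \<open>\<gamma>\<^sup>2\<^sup>+\<^sup>\<nu>\<close>.\<close>

lemma damped_taylor:
  fixes f :: "real ^ 'n \<Rightarrow> real"
  assumes P: "composite_problem N f \<psi> \<nu> H" and x: "x \<in> edom \<psi>" and y: "y \<in> edom \<psi>"
    and \<gamma>: "0 < \<gamma>" "\<gamma> \<le> 1"
  shows "\<bar>f (x + \<gamma> *\<^sub>R (y - x)) - f x - \<gamma> * (gradient f x \<bullet> (y - x))
            - \<gamma>\<^sup>2 / 2 * ((hessian f x *v (y - x)) \<bullet> (y - x))\<bar>
         \<le> \<gamma> powr (2 + \<nu>) * (H * dom_diam N \<psi> powr (2 + \<nu>) / ((1 + \<nu>) * (2 + \<nu>)))"
proof -
  define D where "D = dom_diam N \<psi>"
  define w where "w = \<gamma> *\<^sub>R (y - x)"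
  have N: "is_norm N" and \<psi>: "proper_closed_convex \<psi>" and \<nu>: "0 \<le> \<nu>" and H: "0 \<le> H"
    and diff: "\<And>z. z \<in> edom \<psi> \<Longrightarrow> twice_cont_diff_at f z"
    and hoelder: "\<And>y z. y \<in> edom \<psi> \<Longrightarrow> z \<in> edom \<psi> \<Longrightarrow>
      mat_norm N (hessian f y - hessian f z) \<le> H * N (y - z) powr \<nu>"
    using P by (auto simp: composite_problem_def)
  have nn: "0 \<le> N z" and sc: "N (r *\<^sub>R z) = \<bar>r\<bar> * N z" for r z
    using N by (auto simp: is_norm_def)
  have D: "N (y - x) \<le> D" "0 \<le> D"
    using dom_diam_upper[OF P x y] nn[of "y - x"] by (auto simp: D_def)
  then have Nw: "N w \<le> \<gamma> * D"
    using \<gamma> by (simp add: w_def sc)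
  have dom: "x + t *\<^sub>R w \<in> edom \<psi>" if "t \<in> {0..1}" for t
    using edom_segment[OF \<psi> x y, of "t * \<gamma>"] that \<gamma> by (simp add: w_def mult_le_one)
  have smooth: "f differentiable (at z)" "gradient f differentiable (at z)" if "z \<in> edom \<psi>" for z
    using diff[OF that] eventually_nhds_x_imp_x by (force simp: twice_cont_diff_at_def)+
  have line: "((\<lambda>t. x + t *\<^sub>R w) has_derivative (\<lambda>s. s *\<^sub>R w)) (at t)" for t
    by (auto intro!: derivative_eq_intros)
  have "\<bar>f (x + 1 *\<^sub>R w) - f (x + 0 *\<^sub>R w) - gradient f (x + 0 *\<^sub>R w) \<bullet> w
            - (hessian f (x + 0 *\<^sub>R w) *v w) \<bullet> w / 2\<bar>
        \<le> (H * (\<gamma> * D) powr (2 + \<nu>)) / ((1 + \<nu>) * (2 + \<nu>))"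
  proof (rule holder_taylor[OF \<nu>, where \<phi>' = "\<lambda>t. gradient f (x + t *\<^sub>R w) \<bullet> w"])
    fix t :: real assume t: "t \<in> {0..1}"
    have "(f has_derivative (\<lambda>h. h \<bullet> gradient f (x + t *\<^sub>R w))) (at (x + t *\<^sub>R w))"
      using gderiv_gradient[OF smooth(1)[OF dom[OF t]]] by (simp add: gderiv_def)
    from has_derivative_compose[OF line this]
    show "((\<lambda>t. f (x + t *\<^sub>R w)) has_real_derivative gradient f (x + t *\<^sub>R w) \<bullet> w) (at t)"
      by (simp add: has_field_derivative_def inner_commute mult.commute[of _ "_ \<bullet> _"])
    have "(gradient f has_derivative (\<lambda>h. hessian f (x + t *\<^sub>R w) *v h)) (at (x + t *\<^sub>R w))"
      using smooth(2)[OF dom[OF t]] by (simp add: jacobian_works hessian_def)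
    from has_derivative_inner_left[OF has_derivative_compose[OF line this], of w]
    show "((\<lambda>t. gradient f (x + t *\<^sub>R w) \<bullet> w)
        has_real_derivative (hessian f (x + t *\<^sub>R w) *v w) \<bullet> w) (at t)"
      by (simp add: has_field_derivative_def matrix_vector_mult_scaleR
          mult.commute[of _ "_ \<bullet> _"])
  next
    fix t :: real assume t: "t \<in> {0<..<1}"
    have "\<bar>((hessian f (x + t *\<^sub>R w) - hessian f x) *v w) \<bullet> w\<bar>
      \<le> mat_norm N (hessian f (x + t *\<^sub>R w) - hessian f x) * (N w)\<^sup>2"
      by (rule quadratic_form_le_mat_norm[OF N])
    also have "\<dots> \<le> (H * N (t *\<^sub>R w) powr \<nu>) * (N w)\<^sup>2"
      using hoelder[OF dom[of t] x] t by (intro mult_right_mono) auto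
    also have "\<dots> = H * (t powr \<nu> * (N w powr \<nu> * (N w)\<^sup>2))"
      using t nn[of w] by (simp add: sc powr_mult)
    also have "\<dots> \<le> H * (t powr \<nu> * ((\<gamma> * D) powr \<nu> * (\<gamma> * D)\<^sup>2))"
      using Nw nn[of w] H \<nu> by (intro mult_left_mono mult_mono powr_mono2 power_mono) auto
    also have "(\<gamma> * D) powr \<nu> * (\<gamma> * D)\<^sup>2 = (\<gamma> * D) powr (2 + \<nu>)"
      using \<gamma> D by (cases "D = 0") (auto simp: powr_add)
    finally show "\<bar>(hessian f (x + t *\<^sub>R w) *v w) \<bullet> w - (hessian f (x + 0 *\<^sub>R w) *v w) \<bullet> w\<bar>
        \<le> (H * (\<gamma> * D) powr (2 + \<nu>)) * t powr \<nu>"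
      by (simp add: matrix_vector_mult_diff_rdistrib inner_diff_left mult_ac)
  qed
  also have "(H * (\<gamma> * D) powr (2 + \<nu>)) / ((1 + \<nu>) * (2 + \<nu>))
      = \<gamma> powr (2 + \<nu>) * (H * D powr (2 + \<nu>) / ((1 + \<nu>) * (2 + \<nu>)))"
    using \<gamma> D by (simp add: powr_mult)
  finally show ?thesis
    by (simp add: w_def D_def matrix_vector_mult_scaleR power2_eq_square mult_ac)
qed

section \<open>Two-sided bounds for the estimating functions\<close>

text \<open>The quantity \<open>\<delta>\<^sub>k\<close>: the increment of \<open>C\<^sub>k / 2\<close>, and the Taylor error of step \<open>k\<close>
  weighted by \<open>A\<^sub>k\<^sub>+\<^sub>1\<close>.\<close>

definition step_error :: "real \<Rightarrow> real \<Rightarrow> real \<Rightarrow> (nat \<Rightarrow> real) \<Rightarrow> nat \<Rightarrow> real" where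
  "step_error \<nu> H D a k =
     a (Suc k) * agg_gamma a k powr (1 + \<nu>) * (H * D powr (2 + \<nu>) / ((1 + \<nu>) * (2 + \<nu>)))"

lemma agg_C_Suc: "agg_C \<nu> H D a (Suc k) / 2 = agg_C \<nu> H D a k / 2 + step_error \<nu> H D a k"
proof -
  \<comment> \<open>Abbreviating the common denominator prevents the simplifier from expanding it.\<close>
  define q where "q = (1 + \<nu>) * (2 + \<nu>)"
  show ?thesis
    unfolding agg_C_def step_error_def q_def[symmetric]
    by (simp add: add_divide_distrib distrib_left mult_ac)
qed

declare agg_A.simps(2) [simp del] agg_Q.simps(2) [simp del]

locale newton_run =
  fixes N :: "real ^ 'n \<Rightarrow> real" and f \<psi> \<nu> H a x v
  assumes problem: "composite_problem N f \<psi> \<nu> H" and run: "aggregating_newton f \<psi> a x v"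
begin

abbreviation "D \<equiv> dom_diam N \<psi>"
abbreviation "Q \<equiv> agg_Q f \<psi> a x"
abbreviation "A \<equiv> agg_A a"
abbreviation "\<gamma> \<equiv> agg_gamma a"
abbreviation "C \<equiv> agg_C \<nu> H D a"

text \<open>The real values of \<open>\<psi>\<close> on its domain; a constant rather than an abbreviation, so that
  rewriting \<open>\<psi> y\<close> to \<open>ereal (p y)\<close> terminates.\<close>

definition p :: "real ^ 'n \<Rightarrow> real" where
  "p y = real_of_ereal (\<psi> y)"

definition newton_model :: "nat \<Rightarrow> real ^ 'n \<Rightarrow> real" where
  "newton_model k y = f (x k) + gradient f (x k) \<bullet> (y - x k)
     + \<gamma> k / 2 * ((hessian f (x k) *v (y - x k)) \<bullet> (y - x k))"

lemma \<psi>: "proper_closed_convex \<psi>"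
  using problem by (simp add: composite_problem_def)

lemma \<psi>_finite: "y \<in> edom \<psi> \<Longrightarrow> \<psi> y = ereal (p y)"
  unfolding p_def by (rule real_of_convex_function[OF \<psi>])

lemma a_pos: "a (Suc k) > 0"
  using run by (simp add: aggregating_newton_def)

lemma A_nonneg: "A k \<ge> 0"
  by (induction k) (use a_pos in \<open>auto simp: agg_A.simps(2) intro: add_nonneg_nonneg less_imp_le\<close>)

lemma A_Suc_pos: "A (Suc k) > 0"
  using A_nonneg[of k] a_pos[of k] by (simp add: agg_A.simps(2))

lemma \<gamma>_pos: "\<gamma> k > 0" and \<gamma>_le_1: "\<gamma> k \<le> 1" and A_\<gamma>: "A (Suc k) * \<gamma> k = a (Suc k)"
  using A_nonneg[of k] a_pos[of k] A_Suc_pos[of k] by (auto simp: agg_gamma_def agg_A.simps(2))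

lemma step_error_alt:
  "A (Suc k) * (\<gamma> k powr (2 + \<nu>) * (H * D powr (2 + \<nu>) / ((1 + \<nu>) * (2 + \<nu>))))
     = step_error \<nu> H D a k"
proof -
  have "\<gamma> k powr (2 + \<nu>) = \<gamma> k * \<gamma> k powr (1 + \<nu>)"
    using \<gamma>_pos[of k] powr_add[of "\<gamma> k" 1 "1 + \<nu>"] by simp
  then show ?thesis
    unfolding step_error_def A_\<gamma>[symmetric] by (simp add: mult_ac)
qed

lemma Q_Suc: "Q (Suc k) y = Q k y + ereal (a (Suc k)) * (ereal (newton_model k y) + \<psi> y)"
  by (simp add: newton_model_def agg_Q.simps(2))

lemma Q_neq_MInf: "Q k y \<noteq> -\<infinity>"
proof (induction k)
  case (Suc k)
  have "\<psi> y \<noteq> -\<infinity>" using \<psi> by (simp add: proper_closed_convex_def)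
  then show ?case
    unfolding Q_Suc using Suc a_pos[of k] by (cases "\<psi> y"; cases "Q k y") auto
qed simp

lemma Q_outside: "y \<notin> edom \<psi> \<Longrightarrow> Q (Suc k) y = \<infinity>"
  unfolding Q_Suc using Q_neq_MInf[of k y] a_pos[of k]
  by (cases "Q k y") (auto simp: edom_def)

lemma Q_finite: "y \<in> edom \<psi> \<Longrightarrow> \<bar>Q k y\<bar> \<noteq> \<infinity>"
proof (induction k)
  case (Suc k)
  then show ?case
    unfolding Q_Suc \<psi>_finite[OF Suc.prems] by (cases "Q k y") auto
qed simp

lemma Q_v_le: "Q (Suc k) (v (Suc k)) \<le> Q (Suc k) y"
  using run by (auto simp: aggregating_newton_def is_arg_min_def not_less)

text \<open>Outside the domain of \<open>\<psi>\<close> the estimating function is infinite, whereas it is finite at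
  \<open>x 0\<close>, so its minimiser lies in the domain.\<close>

lemma v_in_edom: "v (Suc k) \<in> edom \<psi>"
proof (rule ccontr)
  assume "v (Suc k) \<notin> edom \<psi>"
  then have "Q (Suc k) (x 0) = \<infinity>"
    using Q_v_le[of k "x 0"] Q_outside by simp
  moreover have "x 0 \<in> edom \<psi>"
    using run by (simp add: aggregating_newton_def)
  ultimately show False
    using Q_finite[of "x 0" "Suc k"] by simp
qed

lemma x_Suc: "x (Suc k) = x k + \<gamma> k *\<^sub>R (v (Suc k) - x k)"
  using run by (simp add: aggregating_newton_def)

lemma x_in_edom: "x k \<in> edom \<psi>"
proof (induction k)
  case 0
  show ?case using run by (simp add: aggregating_newton_def)
next
  case (Suc k)
  then show ?case
    using edom_segment[OF \<psi> Suc v_in_edom] \<gamma>_pos[of k] \<gamma>_le_1[of k] by (simp add: x_Suc)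
qed

text \<open>The second-order Taylor polynomial of \<open>f\<close> at \<open>x k\<close>, evaluated at step length \<open>\<gamma> k\<close> towards
  \<open>y\<close>, is the convex combination of \<open>f (x k)\<close> and the damped model.  This is what the factor
  \<open>\<gamma> k\<close> in the quadratic term of the model is for.\<close>

lemma taylor_step:
  assumes "y \<in> edom \<psi>"
  shows "A (Suc k) * \<bar>f (x k + \<gamma> k *\<^sub>R (y - x k)) - ((1 - \<gamma> k) * f (x k) + \<gamma> k * newton_model k y)\<bar>
    \<le> step_error \<nu> H D a k"
proof -
  have "f (x k + \<gamma> k *\<^sub>R (y - x k)) - ((1 - \<gamma> k) * f (x k) + \<gamma> k * newton_model k y)
    = f (x k + \<gamma> k *\<^sub>R (y - x k)) - f (x k) - \<gamma> k * (gradient f (x k) \<bullet> (y - x k))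
       - (\<gamma> k)\<^sup>2 / 2 * ((hessian f (x k) *v (y - x k)) \<bullet> (y - x k))"
    by (simp add: newton_model_def algebra_simps power2_eq_square)
  then show ?thesis
    using damped_taylor[OF problem x_in_edom assms \<gamma>_pos \<gamma>_le_1, of k k] A_Suc_pos[of k]
    unfolding step_error_alt[symmetric] by (intro mult_left_mono) auto
qed

text \<open>At \<open>u = v (Suc k)\<close>, where \<open>Q (Suc k)\<close> is smallest, the induction hypothesis
  bounds \<open>Q k u\<close>.  The weights \<open>A k\<close> and \<open>a (Suc k)\<close> are those of the convex combination
  \<open>x (Suc k)\<close> of \<open>x k\<close> and \<open>u\<close>, scaled by \<open>A (Suc k)\<close>, so the values at \<open>x k\<close> and the model
  at \<open>u\<close> recombine to \<open>F (x (Suc k))\<close> up to the Taylor error.\<close>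

lemma estimate_lower:
  "ereal (A k * (f (x k) + p (x k)) - C k / 2) \<le> Q k y"
proof (induction k arbitrary: y)
  case 0
  show ?case by (simp add: agg_C_def)
next
  case (Suc k)
  define u where "u = v (Suc k)"
  have u: "u \<in> edom \<psi>" and x': "x (Suc k) = x k + \<gamma> k *\<^sub>R (u - x k)"
    using v_in_edom x_Suc by (auto simp: u_def)
  have "p (x (Suc k)) \<le> (1 - \<gamma> k) * p (x k) + \<gamma> k * p u"
    using convex_function_segment[OF \<psi> x_in_edom u, of "\<gamma> k" k] \<gamma>_pos[of k] \<gamma>_le_1[of k]
      \<psi>_finite[OF x_in_edom[of "Suc k"]]
    by (simp add: x' flip: p_def)
  from mult_left_mono[OF this, of "A (Suc k)"] A_Suc_pos[of k]
  have \<psi>_step: "A (Suc k) * p (x (Suc k)) \<le> A (Suc k) * (1 - \<gamma> k) * p (x k) + A (Suc k) * \<gamma> k * p u"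
    by (simp add: algebra_simps)
  have split: "A (Suc k) * (1 - \<gamma> k) = A k"
    using A_\<gamma>[of k] by (simp add: agg_A.simps(2) algebra_simps)
  have "A (Suc k) * (f (x (Suc k)) - ((1 - \<gamma> k) * f (x k) + \<gamma> k * newton_model k u))
      \<le> step_error \<nu> H D a k"
    using taylor_step[OF u, of k] A_Suc_pos[of k] unfolding x'
    by (smt (verit, best) mult_left_mono)
  then have "A (Suc k) * f (x (Suc k))
      - (A (Suc k) * (1 - \<gamma> k) * f (x k) + A (Suc k) * \<gamma> k * newton_model k u)
      \<le> step_error \<nu> H D a k"
    by (simp only: algebra_simps)
  then have "A (Suc k) * (f (x (Suc k)) + p (x (Suc k))) - C (Suc k) / 2
      \<le> (A k * (f (x k) + p (x k)) - C k / 2) + a (Suc k) * (newton_model k u + p u)"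
    using \<psi>_step unfolding split A_\<gamma> agg_C_Suc distrib_left by linarith
  also have "ereal \<dots> \<le> Q k u + ereal (a (Suc k)) * (ereal (newton_model k u) + \<psi> u)"
    using add_right_mono[OF Suc.IH[of u], of "ereal (a (Suc k) * (newton_model k u + p u))"]
    by (simp add: \<psi>_finite[OF u])
  also have "\<dots> = Q (Suc k) u" by (simp only: Q_Suc)
  also have "\<dots> \<le> Q (Suc k) y" unfolding u_def by (rule Q_v_le)
  finally show ?case by simp
qed

text \<open>By convexity \<open>f\<close> at \<open>z = x k + \<gamma> k (y - x k)\<close> is at most \<open>(1 - \<gamma> k) f (x k) + \<gamma> k f y\<close>,
  while by the Taylor estimate it is almost \<open>(1 - \<gamma> k) f (x k) + \<gamma> k m y\<close> for the model \<open>m\<close>.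
  Comparing the two shows that \<open>m y\<close> exceeds \<open>f y\<close> by at most the Taylor error over \<open>\<gamma> k\<close>.\<close>

lemma estimate_upper:
  assumes y: "y \<in> edom \<psi>"
  shows "Q k y \<le> ereal (A k * (f y + p y) + C k / 2)"
proof (induction k)
  case 0
  show ?case by (simp add: agg_C_def)
next
  case (Suc k)
  have conv: "convex_on (edom \<psi>) f"
    using problem by (simp add: composite_problem_def)
  have "f (x k + \<gamma> k *\<^sub>R (y - x k)) \<le> (1 - \<gamma> k) * f (x k) + \<gamma> k * f y"
    using convex_onD[OF conv, of "\<gamma> k" "x k" y] \<gamma>_pos[of k] \<gamma>_le_1[of k] x_in_edom[of k] y
    by (simp add: algebra_simps)
  then have "\<gamma> k * newton_model k y - \<gamma> k * f y
      \<le> \<bar>f (x k + \<gamma> k *\<^sub>R (y - x k)) - ((1 - \<gamma> k) * f (x k) + \<gamma> k * newton_model k y)\<bar>"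
    by linarith
  from mult_left_mono[OF this, of "A (Suc k)"] A_Suc_pos[of k] taylor_step[OF y, of k]
  have "A (Suc k) * \<gamma> k * newton_model k y - A (Suc k) * \<gamma> k * f y \<le> step_error \<nu> H D a k"
    by (simp add: algebra_simps)
  then have *: "a (Suc k) * newton_model k y \<le> a (Suc k) * f y + step_error \<nu> H D a k"
    unfolding A_\<gamma> by linarith
  show ?case
    using Suc * unfolding Q_Suc \<psi>_finite[OF y] agg_C_Suc
    by (cases "Q k y") (auto simp: agg_A.simps(2) algebra_simps)
qed

lemma objective_finite: "y \<in> edom \<psi> \<Longrightarrow> objective f \<psi> y = ereal (f y + p y)"
  by (simp add: objective_def \<psi>_finite)

lemma Qmin_lower:
  "ereal (A k) * objective f \<psi> (x k) - ereal (C k / 2) \<le> agg_Qmin f \<psi> a x k"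
  unfolding agg_Qmin_def objective_finite[OF x_in_edom]
  by (rule INF_greatest) (use estimate_lower in simp)

lemma Qmin_attained: "agg_Qmin f \<psi> a x (Suc k) = Q (Suc k) (v (Suc k))"
  unfolding agg_Qmin_def by (intro antisym INF_lower INF_greatest Q_v_le UNIV_I)

lemma Qmin_finite: "\<bar>agg_Qmin f \<psi> a x (Suc k)\<bar> \<noteq> \<infinity>"
  unfolding Qmin_attained by (intro Q_finite v_in_edom)

text \<open>The minimum of \<open>Q\<close> serves as a dual certificate: averaged by \<open>A\<close> and corrected by the
  model errors, it is a lower bound for the optimal value.\<close>

lemma Qmin_le_opt_value:
  "agg_Qmin f \<psi> a x (Suc k) / ereal (A (Suc k)) - ereal (C (Suc k) / (2 * A (Suc k)))
     \<le> opt_value f \<psi>"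
  unfolding opt_value_def
proof (rule INF_greatest)
  fix y
  obtain q where q: "agg_Qmin f \<psi> a x (Suc k) = ereal q"
    using Qmin_finite[of k] by auto
  show "agg_Qmin f \<psi> a x (Suc k) / ereal (A (Suc k)) - ereal (C (Suc k) / (2 * A (Suc k)))
      \<le> objective f \<psi> y"
  proof (cases "y \<in> edom \<psi>")
    case True
    have "agg_Qmin f \<psi> a x (Suc k) \<le> Q (Suc k) y"
      unfolding Qmin_attained by (rule Q_v_le)
    then have "q \<le> A (Suc k) * (f y + p y) + C (Suc k) / 2"
      using order_trans[OF _ estimate_upper[OF True, of "Suc k"]] q by fastforce
    then have "q / A (Suc k) \<le> (A (Suc k) * (f y + p y) + C (Suc k) / 2) / A (Suc k)"
      using A_Suc_pos[of k] by (intro divide_right_mono) auto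
    also have "\<dots> = f y + p y + C (Suc k) / (2 * A (Suc k))"
      using A_Suc_pos[of k] by (simp add: add_divide_distrib)
    finally have "q / A (Suc k) - C (Suc k) / (2 * A (Suc k)) \<le> f y + p y"
      by simp
    then show ?thesis
      using A_Suc_pos[of k] by (simp add: q objective_finite[OF True])
  next
    case False
    then show ?thesis by (simp add: objective_def edom_def)
  qed
qed

lemma primal_dual_gap:
  assumes "k \<ge> 1"
  shows "objective f \<psi> (x k) - opt_value f \<psi>
           \<le> objective f \<psi> (x k) - agg_Qmin f \<psi> a x k / ereal (A k) + ereal (C k / (2 * A k))"
    and "objective f \<psi> (x k) - agg_Qmin f \<psi> a x k / ereal (A k) + ereal (C k / (2 * A k))
           \<le> ereal (C k / A k)"
proof -
  obtain j where k: "k = Suc j"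
    using assms by (cases k) auto
  have A: "A k > 0"
    using A_Suc_pos by (simp only: k)
  obtain q where q: "agg_Qmin f \<psi> a x k = ereal q"
    using Qmin_finite[of j] k by auto
  have F: "objective f \<psi> (x k) = ereal (f (x k) + p (x k))"
    by (rule objective_finite[OF x_in_edom])
  have lo: "ereal (q / A k - C k / (2 * A k)) \<le> opt_value f \<psi>"
    using Qmin_le_opt_value[of j] A q by (simp add: k)
  have "opt_value f \<psi> \<le> objective f \<psi> (x k)"
    unfolding opt_value_def by (rule INF_lower) simp
  with lo obtain w where w: "opt_value f \<psi> = ereal w"
    unfolding F by (cases "opt_value f \<psi>") auto
  show "objective f \<psi> (x k) - opt_value f \<psi>
      \<le> objective f \<psi> (x k) - agg_Qmin f \<psi> a x k / ereal (A k) + ereal (C k / (2 * A k))"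
    using lo A by (simp add: F q w)
  have "A k * (f (x k) + p (x k)) - C k / 2 \<le> q"
    using Qmin_lower[of k] by (simp add: F q)
  then have "(A k * (f (x k) + p (x k)) - C k / 2) / A k \<le> q / A k"
    using A by (intro divide_right_mono) auto
  also have "(A k * (f (x k) + p (x k)) - C k / 2) / A k = f (x k) + p (x k) - C k / (2 * A k)"
    using A by (simp add: diff_divide_distrib)
  finally have "f (x k) + p (x k) - q / A k + C k / (2 * A k) \<le> C k / A k"
    by (simp add: field_simps)
  then show "objective f \<psi> (x k) - agg_Qmin f \<psi> a x k / ereal (A k) + ereal (C k / (2 * A k))
      \<le> ereal (C k / A k)"
    using A by (simp add: F q)
qed

end

section \<open>Cubic growth of the weights\<close>

lemma agg_A_cubic: "cubic_steps a \<Longrightarrow> agg_A a k = real k ^ 3"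
  by (induction k) (auto simp: cubic_steps_def agg_A.simps(2))

text \<open>With \<open>m = i + 1\<close> the term is at most
  \<open>3 m\<^sup>2 (3 / m)\<^sup>1\<^sup>+\<^sup>\<nu> = 3\<^sup>2\<^sup>+\<^sup>\<nu> m\<^sup>1\<^sup>-\<^sup>\<nu>\<close>, which increases with \<open>m\<close> because \<open>\<nu> \<le> 1\<close>.\<close>

lemma cubic_step_bound:
  assumes a: "cubic_steps a" and \<nu>: "0 \<le> \<nu>" "\<nu> \<le> 1" and i: "i < k"
  shows "a (Suc i) * agg_gamma a i powr (1 + \<nu>) \<le> 27 * real k powr (1 - \<nu>)"
proof -
  define m where "m = real (Suc i)"
  have m: "m \<ge> 1" "m \<le> real k"
    using i by (auto simp: m_def)
  have "a (Suc i) = m ^ 3 - (m - 1) ^ 3"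
    using a by (simp add: cubic_steps_def m_def)
  also have "\<dots> = 3 * m\<^sup>2 - 3 * m + 1"
    by (simp add: power3_eq_cube power2_eq_square algebra_simps)
  finally have step: "0 \<le> a (Suc i)" "a (Suc i) \<le> 3 * m\<^sup>2"
    using m self_le_power[of m 2] by auto
  have A: "agg_A a (Suc i) = m ^ 3"
    using agg_A_cubic[OF a] by (simp only: m_def)
  have "agg_gamma a i \<le> 3 * m\<^sup>2 / m ^ 3"
    unfolding agg_gamma_def A using step m by (intro divide_right_mono) auto
  also have "\<dots> = 3 / m"
    using m by (simp add: power3_eq_cube power2_eq_square)
  finally have \<gamma>: "agg_gamma a i \<le> 3 / m" .
  have \<gamma>0: "0 \<le> agg_gamma a i"
    unfolding agg_gamma_def A using step m by simp
  have "a (Suc i) * agg_gamma a i powr (1 + \<nu>) \<le> 3 * m\<^sup>2 * (3 / m) powr (1 + \<nu>)"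
    using step \<gamma> \<gamma>0 \<nu> m by (intro mult_mono powr_mono2) auto
  also have "\<dots> = 3 * 3 powr (1 + \<nu>) * (m powr 2 / m powr (1 + \<nu>))"
    using m by (simp add: powr_divide)
  also have "m powr 2 / m powr (1 + \<nu>) = m powr (1 - \<nu>)"
    by (simp flip: powr_diff)
  also have "3 * 3 powr (1 + \<nu>) * m powr (1 - \<nu>) \<le> 3 * 3 powr 2 * real k powr (1 - \<nu>)"
    using m \<nu> by (intro mult_mono powr_mono powr_mono2) auto
  finally show ?thesis by simp
qed

text \<open>Summing \<open>k\<close> equal bounds gives \<open>27 k\<^sup>2\<^sup>-\<^sup>\<nu> = 27 k\<^sup>3 / k\<^sup>1\<^sup>+\<^sup>\<nu>\<close>, and the factor
  \<open>2 / ((1 + \<nu>) (2 + \<nu>))\<close> is at most \<open>1\<close>.\<close>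

lemma agg_C_cubic_bound:
  assumes \<nu>: "0 \<le> \<nu>" "\<nu> \<le> 1" and H: "0 \<le> H" and a: "cubic_steps a" and k: "k \<ge> 1"
  shows "agg_C \<nu> H D a k / agg_A a k \<le> 27 * (H * D powr (2 + \<nu>) / real k powr (1 + \<nu>))"
proof -
  have kpos: "real k > 0" using k by simp
  have "(\<Sum>i<k. a (Suc i) * agg_gamma a i powr (1 + \<nu>)) \<le> (\<Sum>i<k. 27 * real k powr (1 - \<nu>))"
    using cubic_step_bound[OF a \<nu>] by (intro sum_mono) auto
  also have "\<dots> = 27 * (real k * real k powr (1 - \<nu>))" by simp
  also have "real k * real k powr (1 - \<nu>) = real k ^ 3 / real k powr (1 + \<nu>)"
    using kpos by (simp add: powr_diff powr_add power3_eq_cube)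
  finally have sum: "(\<Sum>i<k. a (Suc i) * agg_gamma a i powr (1 + \<nu>))
    \<le> 27 * (real k ^ 3 / real k powr (1 + \<nu>))" .
  have "2 * (H * D powr (2 + \<nu>)) \<le> (1 + \<nu>) * (2 + \<nu>) * (H * D powr (2 + \<nu>))"
    using \<nu> H mult_mono[of 1 "1 + \<nu>" 2 "2 + \<nu>"] by (intro mult_right_mono) auto
  then have "2 * H * D powr (2 + \<nu>) / ((1 + \<nu>) * (2 + \<nu>)) \<le> H * D powr (2 + \<nu>)"
    using \<nu> by (simp add: pos_divide_le_eq mult_ac)
  then have "agg_C \<nu> H D a k \<le> H * D powr (2 + \<nu>) * (27 * (real k ^ 3 / real k powr (1 + \<nu>)))"
    unfolding agg_C_def using sum \<nu> H kpos
    by (intro order_trans[OF mult_left_mono[OF sum] mult_right_mono]) auto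
  then show ?thesis
    using kpos by (simp add: agg_A_cubic[OF a] field_simps)
qed

section \<open>The complexity bound\<close>

theorem theorem4:
  shows "(\<forall>(N :: real ^ 'n \<Rightarrow> real) f \<psi> \<nu> H a x v.
            composite_problem N f \<psi> \<nu> H \<and> aggregating_newton f \<psi> a x v \<longrightarrow>
            (\<forall>k\<ge>1. agg_Qmin f \<psi> a x k \<ge>
               ereal (agg_A a k) * objective f \<psi> (x k) - ereal (agg_C \<nu> H (dom_diam N \<psi>) a k / 2)))
       \<and> (\<exists>C>0.
            (\<forall>\<nu> H D a k. 0 \<le> \<nu> \<and> \<nu> \<le> 1 \<and> 0 \<le> H \<and> 0 \<le> D \<and> cubic_steps a \<and> k \<ge> 1 \<longrightarrow>
               agg_C \<nu> H D a k / agg_A a k \<le> C * (H * D powr (2 + \<nu>) / real k powr (1 + \<nu>)))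
          \<and> (\<forall>(N :: real ^ 'n \<Rightarrow> real) f \<psi> \<nu> H a x v.
               composite_problem N f \<psi> \<nu> H \<and> aggregating_newton f \<psi> a x v \<and> cubic_steps a \<longrightarrow>
               (\<forall>k\<ge>1.
                  let D = dom_diam N \<psi>;
                      F = objective f \<psi>;
                      A\<^sub>k = agg_A a k;
                      C\<^sub>k = agg_C \<nu> H D a k
                  in F (x k) - opt_value f \<psi>
                       \<le> F (x k) - agg_Qmin f \<psi> a x k / ereal A\<^sub>k + ereal (C\<^sub>k / (2 * A\<^sub>k))
                   \<and> F (x k) - agg_Qmin f \<psi> a x k / ereal A\<^sub>k + ereal (C\<^sub>k / (2 * A\<^sub>k))
                       \<le> ereal (C\<^sub>k / A\<^sub>k)
                   \<and> C\<^sub>k / A\<^sub>k \<le> C * (H * D powr (2 + \<nu>) / real k powr (1 + \<nu>)))))"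
proof (intro conjI allI impI exI[of _ 27])
  fix N :: "real ^ 'n \<Rightarrow> real" and f \<psi> \<nu> H a x v and k :: nat
  assume "composite_problem N f \<psi> \<nu> H \<and> aggregating_newton f \<psi> a x v"
  then interpret newton_run N f \<psi> \<nu> H a x v
    by unfold_locales auto
  show "ereal (agg_A a k) * objective f \<psi> (x k) - ereal (agg_C \<nu> H (dom_diam N \<psi>) a k / 2)
      \<le> agg_Qmin f \<psi> a x k"
    by (rule Qmin_lower)
next
  fix \<nu> H D :: real and a and k :: nat
  assume "0 \<le> \<nu> \<and> \<nu> \<le> 1 \<and> 0 \<le> H \<and> 0 \<le> D \<and> cubic_steps a \<and> k \<ge> 1"
  then show "agg_C \<nu> H D a k / agg_A a k \<le> 27 * (H * D powr (2 + \<nu>) / real k powr (1 + \<nu>))"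
    by (intro agg_C_cubic_bound) auto
next
  fix N :: "real ^ 'n \<Rightarrow> real" and f \<psi> \<nu> H a x v and k :: nat
  assume *: "composite_problem N f \<psi> \<nu> H \<and> aggregating_newton f \<psi> a x v \<and> cubic_steps a"
    and k: "k \<ge> 1"
  interpret newton_run N f \<psi> \<nu> H a x v
    using * by unfold_locales auto
  have "0 \<le> \<nu>" "\<nu> \<le> 1" "0 \<le> H"
    using * by (auto simp: composite_problem_def)
  then have "C k / A k \<le> 27 * (H * D powr (2 + \<nu>) / real k powr (1 + \<nu>))"
    using * k by (intro agg_C_cubic_bound) auto
  with primal_dual_gap[OF k]
  show "let D = dom_diam N \<psi>; F = objective f \<psi>; A\<^sub>k = agg_A a k; C\<^sub>k = agg_C \<nu> H D a k
    in F (x k) - opt_value f \<psi>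
         \<le> F (x k) - agg_Qmin f \<psi> a x k / ereal A\<^sub>k + ereal (C\<^sub>k / (2 * A\<^sub>k))
     \<and> F (x k) - agg_Qmin f \<psi> a x k / ereal A\<^sub>k + ereal (C\<^sub>k / (2 * A\<^sub>k)) \<le> ereal (C\<^sub>k / A\<^sub>k)
     \<and> C\<^sub>k / A\<^sub>k \<le> 27 * (H * D powr (2 + \<nu>) / real k powr (1 + \<nu>))"
    unfolding Let_def by blast
qed simp

end
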